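(* For all positive integers $n$ and $m$, the complete bipartite graph $K_{n,m}$ satisfies $d(K_{n,m})=\left\lceil\frac{n+m-1}{2}\right\rceil$.
   Context: A vertex labeling of a graph $G$ is an injective map $f:V(G)\to\mathbb{Z}$. It induces the edge labeling $f^-:E(G)\to\mathbb{Z}$, $f^-(uv)=|f(u)-f(v)|$, and $|f^-|$ denotes the number of distinct values $f^-$ takes on $E(G)$. The difference index $d(G)$ is the minimum positive integer $k$ such that there exists a vertex labeling $f$ of $G$ with $|f^-|=k$. *)

theory Defs
  imports Complex_Main "Graph_Theory.Graph_Theory"
begin

text \<open>
  Finite simple undirected graphs are represented as in the imported library, by the locale
  \<^locale>\<open>graph\<close>: an edge \<open>uv\<close> is a pair of opposite arcs \<open>(u,v)\<close> and \<open>(v,u)\<close>. The edge label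
  induced by a vertex labeling takes the same value on both arcs, so its set of values on the arcs
  is its set of values on the edges.
\<close>

definition vertex_labeling :: "('a, 'b) pre_digraph \<Rightarrow> ('a \<Rightarrow> int) \<Rightarrow> bool" where
  "vertex_labeling G f \<longleftrightarrow> inj_on f (verts G)"

definition edge_label :: "('a, 'b) pre_digraph \<Rightarrow> ('a \<Rightarrow> int) \<Rightarrow> 'b \<Rightarrow> int" where
  "edge_label G f e = \<bar>f (tail G e) - f (head G e)\<bar>"

definition num_edge_labels :: "('a, 'b) pre_digraph \<Rightarrow> ('a \<Rightarrow> int) \<Rightarrow> nat" where
  "num_edge_labels G f = card (edge_label G f ` arcs G)"

text \<open>
  The minimum below is only meaningful for a graph with at least one edge; it then exists, by
  \<open>difference_index_attained\<close>.
\<close>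

definition difference_index :: "('a, 'b) pre_digraph \<Rightarrow> nat" where
  "difference_index G = (LEAST k. 0 < k \<and> (\<exists>f. vertex_labeling G f \<and> num_edge_labels G f = k))"

lemma difference_index_attained:
  assumes "graph G" and "arcs G \<noteq> {}"
  shows "0 < difference_index G
    \<and> (\<exists>f. vertex_labeling G f \<and> num_edge_labels G f = difference_index G)"
proof -
  interpret graph G by (rule assms(1))
  obtain g :: "'a \<Rightarrow> nat" where g: "inj_on g (verts G)"
    using finite_imp_inj_to_nat_seg[OF finite_verts] by blast
  have "vertex_labeling G (int \<circ> g)"
    unfolding vertex_labeling_def using g by (auto simp: inj_on_def)
  moreover have "0 < num_edge_labels G (int \<circ> g)"
    unfolding num_edge_labels_def using assms(2) by (simp add: card_gt_0_iff)
  ultimately have "\<exists>k. 0 < k \<and> (\<exists>f. vertex_labeling G f \<and> num_edge_labels G f = k)"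
    by blast
  then show ?thesis
    unfolding difference_index_def by (rule LeastI_ex)
qed

end

theory Submission
  imports Defs
begin

text \<open>
  A labeling of \<open>K\<^bsub>n,m\<^esub>\<close> amounts to two disjoint sets \<open>A\<close>, \<open>B\<close> of integers with \<open>n\<close> and \<open>m\<close>
  elements, the labels of the two sides, and the edge labels are the absolute values of the elements
  of the difference set \<open>A - B\<close>.

  Lower bound: a difference set of finite nonempty sets of integers has at least \<open>n + m - 1\<close> elements
  (\<open>card_difference_set_ge\<close>), and taking absolute values identifies at most two of them, so there
  are at least \<open>(n + m - 1) / 2\<close> edge labels.

  Upper bound: the first estimate is sharp when \<open>A\<close> and \<open>B\<close> are arithmetic progressions with
  the same common difference. Take this to be 2, with \<open>A\<close> even and \<open>B\<close> odd. Then \<open>A - B\<close> consists of \<open>n + m - 1\<close>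
  consecutive odd numbers, which can be shifted so that they lie as symmetrically about 0 as
  possible. Differences being odd, 0 is avoided, so \<open>A\<close> and \<open>B\<close> are disjoint. With
  \<open>k = (n + m) div 2\<close>, all edge labels are among the \<open>k\<close> odd numbers \<open>1, 3, \<dots>, 2 k - 1\<close>, and
  \<open>k\<close> is the lower bound rounded up.
\<close>

text \<open>
  The differences \<open>a - Max B\<close> are all at most \<open>Max A - Max B\<close>, the differences \<open>Max A - b\<close> are all
  at least that, so these two families share a single value.
\<close>

lemma card_difference_set_ge:
  fixes A B :: "'a :: linordered_ab_group_add set"
  assumes "finite A" "A \<noteq> {}" "finite B" "B \<noteq> {}"
  shows "card A + card B \<le> card ((\<lambda>(a, b). a - b) ` (A \<times> B)) + 1"
proof -
  let ?S = "(\<lambda>a. a - Max B) ` A"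
  let ?T = "(\<lambda>b. Max A - b) ` B"
  have "?S \<inter> ?T \<subseteq> {Max A - Max B}"
  proof
    fix x assume "x \<in> ?S \<inter> ?T"
    then obtain a b where ab: "a \<in> A" "x = a - Max B" "b \<in> B" "x = Max A - b"
      by blast
    have "x \<le> Max A - Max B"
      using ab(1,2) assms(1) by (simp add: diff_right_mono)
    moreover have "Max A - Max B \<le> x"
      using ab(3,4) assms(3) by (simp add: diff_left_mono)
    ultimately show "x \<in> {Max A - Max B}" by simp
  qed
  then have "card (?S \<inter> ?T) \<le> 1"
    using card_mono[of "{Max A - Max B}"] by simp
  moreover have "card ?S = card A" "card ?T = card B"
    by (auto intro!: card_image simp: inj_on_def)
  moreover have "card ?S + card ?T = card (?S \<union> ?T) + card (?S \<inter> ?T)"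
    using assms by (intro card_Un_Int) auto
  moreover have "card (?S \<union> ?T) \<le> card ((\<lambda>(a, b). a - b) ` (A \<times> B))"
  proof (rule card_mono)
    show "?S \<union> ?T \<subseteq> (\<lambda>(a, b). a - b) ` (A \<times> B)"
      using Max_in[OF assms(1,2)] Max_in[OF assms(3,4)] by force
  qed (use assms in auto)
  ultimately show ?thesis by linarith
qed

lemma card_le_twice_card_abs:
  fixes S :: "'a :: linordered_idom set"
  assumes "finite S"
  shows "card S \<le> 2 * card (abs ` S)"
proof -
  have "S \<subseteq> abs ` S \<union> uminus ` abs ` S"
  proof
    fix x assume "x \<in> S"
    moreover have "x = \<bar>x\<bar> \<or> x = - \<bar>x\<bar>"
      by (simp add: abs_if)
    ultimately show "x \<in> abs ` S \<union> uminus ` abs ` S"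
      by blast
  qed
  then have "card S \<le> card (abs ` S \<union> uminus ` abs ` S)"
    using assms by (intro card_mono) auto
  also have "\<dots> \<le> card (abs ` S) + card (uminus ` abs ` S)"
    by (rule card_Un_le)
  also have "card (uminus ` abs ` S) \<le> card (abs ` S)"
    using assms by (intro card_image_le) auto
  finally show ?thesis by simp
qed

lemma edge_labels_bipartite:
  assumes "arcs_ends G = U \<times> V \<union> V \<times> U"
  shows "edge_label G f ` arcs G = abs ` (\<lambda>(a, b). a - b) ` (f ` U \<times> f ` V)"
proof -
  have "edge_label G f ` arcs G = (\<lambda>(u, v). \<bar>f u - f v\<bar>) ` arcs_ends G"
    by (auto simp: edge_label_def arcs_ends_def arc_to_ends_def image_image)
  also have "\<dots> = (\<lambda>(u, v). \<bar>f u - f v\<bar>) ` (U \<times> V)"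
    unfolding assms image_Un by (auto simp: image_iff) (metis abs_minus_commute)
  also have "\<dots> = abs ` (\<lambda>(a, b). a - b) ` (f ` U \<times> f ` V)"
    by (force simp: image_iff)
  finally show ?thesis .
qed

lemma num_edge_labels_bipartite_ge:
  assumes ends: "arcs_ends G = U \<times> V \<union> V \<times> U"
    and lab: "vertex_labeling G f" "U \<union> V \<subseteq> verts G"
    and fin: "finite U" "U \<noteq> {}" "finite V" "V \<noteq> {}"
  shows "card U + card V \<le> 2 * num_edge_labels G f + 1"
proof -
  let ?D = "(\<lambda>(a, b). a - b) ` (f ` U \<times> f ` V)"
  have "inj_on f U" "inj_on f V"
    using lab by (auto simp: vertex_labeling_def intro: inj_on_subset)
  then have "card U + card V = card (f ` U) + card (f ` V)"
    by (simp add: card_image)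
  also have "\<dots> \<le> card ?D + 1"
    using fin by (intro card_difference_set_ge) auto
  also have "card ?D \<le> 2 * card (abs ` ?D)"
    using fin by (intro card_le_twice_card_abs) auto
  finally show ?thesis
    by (simp add: num_edge_labels_def edge_labels_bipartite[OF ends])
qed

text \<open>
  The label sets are \<open>{2 i | i < card U}\<close> and \<open>{2 j + c | j < card V}\<close>, so the differences are the
  odd numbers from \<open>- 2 (card V - 1) - c\<close> to \<open>2 (card U - 1) - c\<close>.
\<close>

lemma bipartite_labeling_few_labels:
  assumes ends: "arcs_ends G = U \<times> V \<union> V \<times> U"
    and verts: "verts G = U \<union> V" "U \<inter> V = {}"
    and fin: "finite U" "finite V"
  shows "\<exists>f. vertex_labeling G f \<and> num_edge_labels G f \<le> (card U + card V) div 2"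
proof -
  define k where "k = (card U + card V) div 2"
  \<comment> \<open>This offset makes the least difference equal to \<open>- (2 k - 1)\<close>; the greatest one is then
    \<open>2 (card U + card V - k) - 3\<close>, which is at most \<open>2 k - 1\<close>.\<close>
  define c where "c = 2 * int k - 2 * int (card V) + 1"
  obtain g where g: "bij_betw g U {0..<card U}"
    using ex_bij_betw_finite_nat[OF fin(1)] by blast
  obtain h where h: "bij_betw h V {0..<card V}"
    using ex_bij_betw_finite_nat[OF fin(2)] by blast
  define f where "f v = (if v \<in> U then 2 * int (g v) else 2 * int (h v) + c)" for v
  have fU: "f v = 2 * int (g v)" if "v \<in> U" for v
    using that by (simp add: f_def)
  have fV: "f v = 2 * int (h v) + c" if "v \<in> V" for v
    using that verts(2) by (auto simp: f_def)
  have "inj_on f U" "inj_on f V"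
    using g h by (auto simp: bij_betw_def inj_on_def fU fV)
  moreover have "f u \<noteq> f v" if "u \<in> U" "v \<in> V" for u v
    unfolding fU[OF that(1)] fV[OF that(2)] c_def by presburger
  then have "f ` U \<inter> f ` V = {}"
    by auto
  ultimately have "vertex_labeling G f"
    unfolding vertex_labeling_def verts(1) by (auto simp: inj_on_Un)
  moreover have "num_edge_labels G f \<le> k"
  proof -
    have "edge_label G f ` arcs G \<subseteq> (\<lambda>i. 2 * int i + 1) ` {..<k}"
    proof
      fix x assume "x \<in> edge_label G f ` arcs G"
      then obtain u v where uv: "u \<in> U" "v \<in> V" and x: "x = \<bar>f u - f v\<bar>"
        unfolding edge_labels_bipartite[OF ends] by auto
      have gh: "g u < card U" "h v < card V"
        using g h uv by (auto simp: bij_betw_def)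
      have x': "x = \<bar>2 * (int (g u) - int (h v) - int k + int (card V)) - 1\<bar>"
        unfolding x fU[OF uv(1)] fV[OF uv(2)] c_def by (simp add: algebra_simps)
      then have "odd x" by simp
      moreover have "0 \<le> x" "x < 2 * int k"
        using x' gh by (auto simp: k_def)
      ultimately have "x = 2 * int (nat (x div 2)) + 1" "nat (x div 2) < k"
        by (auto elim!: oddE)
      then show "x \<in> (\<lambda>i. 2 * int i + 1) ` {..<k}"
        by blast
    qed
    then have "card (edge_label G f ` arcs G) \<le> card {..<k}"
      by (intro surj_card_le) auto
    then show ?thesis
      by (simp add: num_edge_labels_def)
  qed
  ultimately show ?thesis
    unfolding k_def by blast
qed

theorem theorem3p6:
  fixes G :: "('a, 'b) pre_digraph" and n m :: nat
  assumes "n \<ge> 1" and "m \<ge> 1"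
    and "complete_bipartite_digraph n m G"
  shows "int (difference_index G) = \<lceil>(real n + real m - 1) / 2\<rceil>"
proof -
  obtain U V where verts: "verts G = U \<union> V" "U \<inter> V = {}"
    and card: "card U = n" "card V = m" and ends: "arcs_ends G = U \<times> V \<union> V \<times> U"
    using assms(3) unfolding complete_bipartite_digraph_def by blast
  have fin: "finite U" "U \<noteq> {}" "finite V" "V \<noteq> {}"
    using card assms(1,2) by (auto intro: card_ge_0_finite)
  have ge: "(n + m) div 2 \<le> num_edge_labels G f" if "vertex_labeling G f" for f
    using num_edge_labels_bipartite_ge[OF ends that _ fin] verts card by simp
  obtain f where f: "vertex_labeling G f" "num_edge_labels G f \<le> (n + m) div 2"
    using bipartite_labeling_few_labels[OF ends verts fin(1,3)] card by blast
  have "difference_index G = (n + m) div 2"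
    unfolding difference_index_def
  proof (rule Least_equality)
    have "num_edge_labels G f = (n + m) div 2"
      using ge f by (simp add: le_antisym)
    then show "0 < (n + m) div 2 \<and>
        (\<exists>f. vertex_labeling G f \<and> num_edge_labels G f = (n + m) div 2)"
      using f(1) assms(1,2) by auto
  next
    fix k assume "0 < k \<and> (\<exists>f. vertex_labeling G f \<and> num_edge_labels G f = k)"
    then show "(n + m) div 2 \<le> k" using ge by blast
  qed
  moreover have "\<lceil>(real n + real m - 1) / 2\<rceil> = int ((n + m) div 2)"
  proof (cases "even (n + m)")
    case True
    then obtain k where k: "n + m = 2 * k" by blast
    then have "real n + real m = 2 * real k" by linarith
    then show ?thesis unfolding k by (simp add: ceiling_eq_iff)
  next
    case False
    then obtain k where k: "n + m = 2 * k + 1" by (elim oddE)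
    then have "real n + real m = 2 * real k + 1" by linarith
    then show ?thesis unfolding k by simp
  qed
  ultimately show ?thesis by simp
qed

end
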